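(* Let $\mathcal{H}$ be a separable complex Hilbert space and let $\{T(t)\}_{t\in\mathbb{R}}$ be a family of densely defined, closed operators in $\mathcal{H}$. Suppose that there exists a (Lebesgue) measurable function $\mathbb{R}\ni t\mapsto\alpha(t)\in\mathbb{C}$ such that $\alpha(t)\in\rho(T(t))$ for a.e. $t\in\mathbb{R}$, and, in addition, the family of bounded operators $\{(T(t)-\alpha(t)I_{\mathcal{H}})^{-1}\}_{t\in\mathbb{R}}$ is weakly measurable. Then the family $\{T(t)\}_{t\in\mathbb{R}}$ is $N$-measurable.
   Context: The scalar product $(\cdot,\cdot)_{\mathcal{H}}$ is linear in the second argument; $\rho(\cdot)$ denotes the resolvent set; $I_{\mathcal{H}}$ is the identity operator. Measurability and "a.e." refer to (complete) Lebesgue measure on $\mathbb{R}$, so exceptional null sets on which $(T(t)-\alpha(t)I_{\mathcal{H}})^{-1}$ is not defined play no role. A family of vectors $\{g(t)\}_{t\in\mathbb{R}}\subset\mathcal{H}$ is called weakly measurable if $t\mapsto (h,g(t))_{\mathcal{H}}$ is Lebesgue measurable for every $h\in\mathcal{H}$. A family $\{S(t)\}_{t\in\mathbb{R}}$ of densely defined, closed, linear operators in $\mathcal{H}$ is called weakly measurable if for every weakly measurable family of vectors $\{f(t)\}_{t\in\mathbb{R}}$ in $\mathcal{H}$ with $f(t)\in\operatorname{dom}(S(t))$ for all $t\in\mathbb{R}$, the family $\{S(t)f(t)\}_{t\in\mathbb{R}}$ is weakly measurable; for families of bounded operators $S(t)\in\mathcal{B}(\mathcal{H})$ this is equivalent to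 $t\mapsto(g,S(t)h)_{\mathcal{H}}$ being Lebesgue measurable for all $g,h\in\mathcal{H}$. For a densely defined, closed operator $T$ in $\mathcal{H}$, let $\Gamma(T)=\{\langle f,Tf\rangle : f\in\operatorname{dom}(T)\}\subseteq\mathcal{H}\oplus\mathcal{H}$ be its graph and let $P(\Gamma(T))=(P(\Gamma(T))_{j,k})_{1\le j,k\le 2}$ be the orthogonal projection of $\mathcal{H}\oplus\mathcal{H}$ onto $\Gamma(T)$, written as a $2\times 2$ block operator matrix with entries in $\mathcal{B}(\mathcal{H})$. The family $\{T(t)\}_{t\in\mathbb{R}}$ is called $N$-measurable if for all $j,k\in\{1,2\}$ the family of bounded operators $\{P(\Gamma(T(t)))_{j,k}\}_{t\in\mathbb{R}}$ is weakly measurable. *)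

theory Defs
  imports "HOL-Analysis.Analysis"
begin

section \<open>Complex Hilbert spaces\<close>

text \<open>
  The scalar product is linear in the second argument. Its real part is the real inner product
  of the underlying real space, so positive definiteness and the identity
  \<open>norm x = sqrt (Re (cinner x x))\<close> are inherited from \<^class>\<open>real_inner\<close>.
\<close>

class complex_inner = real_inner +
  fixes scaleC :: "complex \<Rightarrow> 'a \<Rightarrow> 'a"  (infixr \<open>*\<^sub>C\<close> 75)
    and cinner :: "'a \<Rightarrow> 'a \<Rightarrow> complex"
  assumes scaleC_add_right: "a *\<^sub>C (x + y) = a *\<^sub>C x + a *\<^sub>C y"
    and scaleC_add_left: "(a + b) *\<^sub>C x = a *\<^sub>C x + b *\<^sub>C x"
    and scaleC_scaleC: "a *\<^sub>C (b *\<^sub>C x) = (a * b) *\<^sub>C x"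
    and scaleC_one: "1 *\<^sub>C x = x"
    and scaleR_scaleC: "r *\<^sub>R x = complex_of_real r *\<^sub>C x"
    and cinner_commute: "cinner x y = cnj (cinner y x)"
    and cinner_add_right: "cinner x (y + z) = cinner x y + cinner x z"
    and cinner_scaleC_right: "cinner x (a *\<^sub>C y) = a * cinner x y"
    and inner_eq_Re_cinner: "inner x y = Re (cinner x y)"

class chilbert_space = complex_inner + complete_space

text \<open>The direct sum of two Hilbert spaces.\<close>

instantiation prod :: (complex_inner, complex_inner) complex_inner
begin

definition scaleC_prod :: "complex \<Rightarrow> 'a \<times> 'b \<Rightarrow> 'a \<times> 'b" where
  "scaleC_prod c z = (c *\<^sub>C fst z, c *\<^sub>C snd z)"

definition cinner_prod :: "'a \<times> 'b \<Rightarrow> 'a \<times> 'b \<Rightarrow> complex" where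
  "cinner_prod z w = cinner (fst z) (fst w) + cinner (snd z) (snd w)"

instance
proof
  fix a b :: complex and r :: real and x y z :: "'a \<times> 'b"
  show "a *\<^sub>C (x + y) = a *\<^sub>C x + a *\<^sub>C y"
    by (simp add: scaleC_prod_def scaleC_add_right)
  show "(a + b) *\<^sub>C x = a *\<^sub>C x + b *\<^sub>C x"
    by (simp add: scaleC_prod_def scaleC_add_left)
  show "a *\<^sub>C (b *\<^sub>C x) = (a * b) *\<^sub>C x"
    by (simp add: scaleC_prod_def scaleC_scaleC)
  show "1 *\<^sub>C x = x"
    by (simp add: scaleC_prod_def scaleC_one)
  show "r *\<^sub>R x = complex_of_real r *\<^sub>C x"
    by (simp add: scaleC_prod_def scaleR_prod_def scaleR_scaleC)
  show "cinner x y = cnj (cinner y x)"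
    by (simp add: cinner_prod_def cinner_commute[of "fst x"] cinner_commute[of "snd x"])
  show "cinner x (y + z) = cinner x y + cinner x z"
    by (simp add: cinner_prod_def cinner_add_right)
  show "cinner x (a *\<^sub>C y) = a * cinner x y"
    by (simp add: cinner_prod_def scaleC_prod_def cinner_scaleC_right distrib_left)
  show "inner x y = Re (cinner x y)"
    by (simp add: cinner_prod_def inner_prod_def inner_eq_Re_cinner)
qed

end

instance prod :: (chilbert_space, chilbert_space) chilbert_space ..

definition csubspace :: "'a::complex_inner set \<Rightarrow> bool" where
  "csubspace M \<longleftrightarrow>
     0 \<in> M \<and> (\<forall>x\<in>M. \<forall>y\<in>M. x + y \<in> M) \<and> (\<forall>c. \<forall>x\<in>M. c *\<^sub>C x \<in> M)"

definition bounded_clinear :: "('a::complex_inner \<Rightarrow> 'b::complex_inner) \<Rightarrow> bool" where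
  "bounded_clinear S \<longleftrightarrow> bounded_linear S \<and> (\<forall>c x. S (c *\<^sub>C x) = c *\<^sub>C S x)"

text \<open>For \<open>M\<close> a closed subspace of a Hilbert space, the projection theorem makes the
  description below unique.\<close>

definition orth_proj :: "'a::complex_inner set \<Rightarrow> 'a \<Rightarrow> 'a" where
  "orth_proj M z = (THE p. p \<in> M \<and> (\<forall>q\<in>M. cinner q (z - p) = 0))"


section \<open>Unbounded operators\<close>

text \<open>
  An operator \<open>T\<close> in the space \<open>'a\<close> is a partial function: its domain is \<open>dom T\<close>, its value at
  \<open>f \<in> dom T\<close> is \<open>the (T f)\<close>, and its graph is \<^term>\<open>Map.graph T\<close>. A total function \<open>S\<close> is the
  operator \<open>Some \<circ> S\<close> with domain \<^term>\<open>UNIV\<close>.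
\<close>

definition linear_operator :: "('a::complex_inner \<rightharpoonup> 'a) \<Rightarrow> bool" where
  "linear_operator T \<longleftrightarrow>
     csubspace (dom T) \<and>
     (\<forall>f\<in>dom T. \<forall>g\<in>dom T. the (T (f + g)) = the (T f) + the (T g)) \<and>
     (\<forall>c. \<forall>f\<in>dom T. the (T (c *\<^sub>C f)) = c *\<^sub>C the (T f))"

definition densely_defined :: "('a::complex_inner \<rightharpoonup> 'a) \<Rightarrow> bool" where
  "densely_defined T \<longleftrightarrow> closure (dom T) = UNIV"

definition closed_operator :: "('a::complex_inner \<rightharpoonup> 'a) \<Rightarrow> bool" where
  "closed_operator T \<longleftrightarrow> closed (Map.graph T)"

text \<open>The resolvent \<open>(T - z I)\<^sup>-\<^sup>1\<close>. It is a total function, whose values are meaningful only for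
  \<open>z\<close> in the resolvent set. For a family \<open>resolvent (T t) (\<alpha> t)\<close> with \<open>\<alpha> t\<close> in the resolvent set of
  \<open>T t\<close> for almost every \<open>t\<close>, the arbitrary values at the remaining \<open>t\<close> do not affect weak
  measurability, since Lebesgue measure is complete.\<close>

definition resolvent :: "('a::complex_inner \<rightharpoonup> 'a) \<Rightarrow> complex \<Rightarrow> 'a \<Rightarrow> 'a" where
  "resolvent T z = inv_into (dom T) (\<lambda>f. the (T f) - z *\<^sub>C f)"

definition resolvent_set :: "('a::complex_inner \<rightharpoonup> 'a) \<Rightarrow> complex set" where
  "resolvent_set T =
     {z. bij_betw (\<lambda>f. the (T f) - z *\<^sub>C f) (dom T) UNIV \<and> bounded_clinear (resolvent T z)}"


section \<open>Measurable families\<close>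

definition weakly_measurable :: "(real \<Rightarrow> 'a::complex_inner) \<Rightarrow> bool" where
  "weakly_measurable g \<longleftrightarrow> (\<forall>h. (\<lambda>t. cinner h (g t)) \<in> borel_measurable lebesgue)"

definition weakly_measurable_op :: "(real \<Rightarrow> 'a::complex_inner \<rightharpoonup> 'a) \<Rightarrow> bool" where
  "weakly_measurable_op S \<longleftrightarrow>
     (\<forall>f. weakly_measurable f \<and> (\<forall>t. f t \<in> dom (S t)) \<longrightarrow>
          weakly_measurable (\<lambda>t. the (S t (f t))))"

text \<open>
  For an operator \<open>P\<close> on the direct sum and \<open>j, k \<in> {1, 2}\<close>, \<open>block_entry P j k\<close> is the entry in
  row \<open>j\<close> and column \<open>k\<close> of its block matrix.
\<close>

definition block_entry ::
    "('a::complex_inner \<times> 'a \<Rightarrow> 'a \<times> 'a) \<Rightarrow> nat \<Rightarrow> nat \<Rightarrow> 'a \<Rightarrow> 'a" where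
  "block_entry P j k h =
     (let w = P (if k = 1 then (h, 0) else (0, h)) in if j = 1 then fst w else snd w)"

definition N_measurable :: "(real \<Rightarrow> 'a::chilbert_space \<rightharpoonup> 'a) \<Rightarrow> bool" where
  "N_measurable T \<longleftrightarrow>
     (\<forall>j\<in>{1, 2}. \<forall>k\<in>{1, 2}.
        weakly_measurable_op (\<lambda>t. Some \<circ> block_entry (orth_proj (Map.graph (T t))) j k))"

end

theory Submission
  imports Defs
begin

text \<open>
  Let \<open>D\<close> be a countable dense subset of the Hilbert space. With \<open>R = (T - \<alpha>)\<^sup>-\<^sup>1\<close>, the graph of \<open>T\<close>
  is the range of the continuous map \<open>V h = (R h, h + \<alpha> R h)\<close>, so the countably many weakly
  measurable vectors \<open>V d\<close> with \<open>d \<in> D\<close> are dense in it. The distance of a weakly measurable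
  \<open>z\<close> to the graph is thus a countable infimum of measurable functions, and the projection \<open>P\<close>
  onto the graph satisfies \<open>\<parallel>P z\<parallel>\<^sup>2 = \<parallel>z\<parallel>\<^sup>2 - dist(z, graph)\<^sup>2\<close>. Polarization recovers the weak
  measurability of \<open>P z\<close> from that of these norms.
\<close>

section \<open>Complex inner product spaces\<close>

lemma cinner_scaleC_left: "cinner (a *\<^sub>C x) y = cnj a * cinner x y"
  by (metis cinner_commute cinner_scaleC_right complex_cnj_mult)

text \<open>Conjugate linearity in the first slot turns the imaginary part into the real part for
  \<open>x\<close> multiplied by the imaginary unit. Complex questions thus become real
  ones.\<close>

lemma cinner_eq_inner: "cinner x y = Complex (inner x y) (inner (\<i> *\<^sub>C x) y)"
  by (simp add: complex_eq_iff inner_eq_Re_cinner cinner_scaleC_left)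

lemma csubspace_imp_subspace: "csubspace M \<Longrightarrow> subspace M"
  by (simp add: csubspace_def subspace_def scaleR_scaleC)

text \<open>\<open>M\<close> is stable under the imaginary unit, so real orthogonality to that
  multiple of \<open>q\<close> removes the imaginary part.\<close>

lemma csubspace_orth_iff:
  assumes "csubspace M"
  shows "(\<forall>q\<in>M. cinner q x = 0) \<longleftrightarrow> (\<forall>q\<in>M. inner q x = 0)"
  using assms by (auto simp: cinner_eq_inner complex_eq_iff csubspace_def)

lemma bounded_linear_scaleC: "bounded_linear (\<lambda>x::'a::complex_inner. a *\<^sub>C x)"
proof (rule bounded_linear_intro[where K = "cmod a"])
  fix x :: 'a
  have "(norm (a *\<^sub>C x))\<^sup>2 = Re (cnj a * a * cinner x x)"
    by (simp add: power2_norm_eq_inner inner_eq_Re_cinner cinner_scaleC_left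
        cinner_scaleC_right mult.assoc mult.left_commute)
  also have "cnj a * a = complex_of_real ((cmod a)\<^sup>2)"
    by (metis complex_norm_square mult.commute)
  finally have "(norm (a *\<^sub>C x))\<^sup>2 = (norm x * cmod a)\<^sup>2"
    by (simp add: power2_norm_eq_inner inner_eq_Re_cinner power_mult_distrib mult.commute)
  then show "norm (a *\<^sub>C x) \<le> norm x * cmod a"
    by (simp add: power2_eq_iff_nonneg)
qed (simp_all add: scaleC_add_right scaleR_scaleC scaleC_scaleC mult.commute)


section \<open>Orthogonal projections\<close>

lemma parallelogram_law:
  fixes x y :: "'a::real_inner"
  shows "(norm (x + y))\<^sup>2 + (norm (x - y))\<^sup>2 = 2 * (norm x)\<^sup>2 + 2 * (norm y)\<^sup>2"
  by (simp add: power2_norm_eq_inner inner_add_left inner_add_right inner_diff_left inner_diff_right)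

text \<open>A minimizing sequence is Cauchy by the parallelogram law, because convexity keeps
  midpoints in \<open>M\<close>; its limit is a nearest point.\<close>

lemma ex_infdist_attained:
  fixes M :: "'a::{real_inner,complete_space} set"
  assumes "convex M" "closed M" "M \<noteq> {}"
  shows "\<exists>p\<in>M. dist z p = infdist z M"
proof -
  define d where "d = infdist z M"
  have d0: "0 \<le> d" by (simp add: d_def infdist_nonneg)
  have "\<exists>y\<in>M. dist z y < d + e" if "e > 0" for e
  proof (rule ccontr)
    assume "\<not> ?thesis"
    then have "d + e \<le> (INF a\<in>M. dist z a)"
      using assms(3) by (intro cINF_greatest) (auto simp: not_less)
    then show False using that assms(3) by (simp add: d_def infdist_notempty)
  qed
  then have "\<exists>y\<in>M. dist z y < d + inverse (real (Suc n))" for n by simp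
  then obtain x where xM: "\<And>n. x n \<in> M" and xd: "\<And>n. dist z (x n) < d + inverse (real (Suc n))"
    by metis
  have "(\<lambda>n. d + inverse (real (Suc n))) \<longlonglongrightarrow> d + 0"
    by (intro tendsto_intros LIMSEQ_inverse_real_of_nat)
  then have lim: "(\<lambda>n. dist z (x n)) \<longlonglongrightarrow> d"
    using xd by (intro tendsto_sandwich[OF _ _ tendsto_const, of d "\<lambda>n. dist z (x n)"])
      (auto simp: d_def infdist_le xM less_imp_le)
  have par: "(dist (x m) (x n))\<^sup>2 \<le> 2 * (dist z (x m))\<^sup>2 + 2 * (dist z (x n))\<^sup>2 - 4 * d\<^sup>2" for m n
  proof -
    have "(1/2) *\<^sub>R x m + (1/2) *\<^sub>R x n \<in> M"
      by (rule convexD[OF assms(1)]) (auto simp: xM)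
    then have "d \<le> dist z ((1/2) *\<^sub>R x m + (1/2) *\<^sub>R x n)" unfolding d_def by (rule infdist_le)
    then have "2 * d \<le> norm (2 *\<^sub>R (z - ((1/2) *\<^sub>R x m + (1/2) *\<^sub>R x n)))"
      by (simp add: dist_norm)
    also have "2 *\<^sub>R (z - ((1/2) *\<^sub>R x m + (1/2) *\<^sub>R x n)) = (z - x m) + (z - x n)"
      by (simp add: algebra_simps scaleR_2)
    finally have "(2 * d)\<^sup>2 \<le> (norm ((z - x m) + (z - x n)))\<^sup>2"
      using d0 by (intro power_mono) auto
    then show ?thesis
      using parallelogram_law[of "z - x m" "z - x n"]
      by (simp add: dist_norm norm_minus_commute power_mult_distrib)
  qed
  have "Cauchy x"
  proof (rule metric_CauchyI)
    fix e :: real assume "0 < e"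
    \<comment> \<open>The margin e^2/4 occurs twice in \<open>par\<close> with factor 2, so the
      total is exactly e^2.\<close>
    have "(\<lambda>n. (dist z (x n))\<^sup>2) \<longlonglongrightarrow> d\<^sup>2" by (intro tendsto_intros lim)
    then obtain N where N: "\<And>n. n \<ge> N \<Longrightarrow> (dist z (x n))\<^sup>2 < d\<^sup>2 + e\<^sup>2 / 4"
      using order_tendstoD(2)[of _ "d\<^sup>2" sequentially "d\<^sup>2 + e\<^sup>2 / 4"] \<open>0 < e\<close>
      by (fastforce simp: eventually_sequentially)
    have "dist (x m) (x n) < e" if "m \<ge> N" "n \<ge> N" for m n
    proof (rule power2_less_imp_less)
      show "(dist (x m) (x n))\<^sup>2 < e\<^sup>2" using par[of m n] N[OF that(1)] N[OF that(2)] by simp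
    qed (use \<open>0 < e\<close> in simp)
    then show "\<exists>N. \<forall>m\<ge>N. \<forall>n\<ge>N. dist (x m) (x n) < e" by blast
  qed
  then obtain p where p: "x \<longlonglongrightarrow> p" using Cauchy_convergent convergent_def by blast
  have "p \<in> M" using closed_sequentially[OF assms(2)] xM p by blast
  moreover have "dist z p = d"
    by (rule LIMSEQ_unique[OF _ lim]) (intro tendsto_intros p)
  ultimately show ?thesis by (auto simp: d_def)
qed

text \<open>The nearest point works: moving it along any \<open>q\<close> in \<open>M\<close> cannot
  decrease the distance to \<open>z\<close>.\<close>

lemma ex_orth_decomposition:
  fixes M :: "'a::{real_inner,complete_space} set"
  assumes "subspace M" "closed M"
  shows "\<exists>p\<in>M. \<forall>q\<in>M. inner q (z - p) = 0"
proof -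
  obtain p where p: "p \<in> M" "dist z p = infdist z M"
    using ex_infdist_attained[of M z] assms subspace_imp_convex subspace_0 by blast
  have "inner q (z - p) = 0" if q: "q \<in> M" for q
  proof (cases "q = 0")
    case False
    \<comment> \<open>This \<open>s\<close> is the real minimizer of
      \<open>norm ((z - p) - s *\<^sub>R q)\<close>, the coefficient of \<open>z - p\<close> along
      \<open>q\<close>.\<close>
    define s where "s = inner q (z - p) / inner q q"
    have "p + s *\<^sub>R q \<in> M" using assms(1) p(1) q by (simp add: subspace_add subspace_scale)
    then have "norm (z - p) \<le> norm (z - (p + s *\<^sub>R q))"
      using infdist_le p(2) by (metis dist_norm)
    then have "(norm (z - p))\<^sup>2 \<le> (norm ((z - p) - s *\<^sub>R q))\<^sup>2"
      by (simp add: diff_diff_eq)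
    also have "\<dots> = (norm (z - p))\<^sup>2 - 2 * s * inner q (z - p) + s * (s * inner q q)"
      unfolding power2_norm_eq_inner
      by (simp add: inner_diff_left[of "z - p"] inner_diff_right[of _ "z - p"]
          inner_commute[of "z - p" q] right_diff_distrib)
    also have "s * inner q q = inner q (z - p)" using False by (simp add: s_def)
    finally have "s * inner q (z - p) \<le> 0" by simp
    then have "(inner q (z - p))\<^sup>2 \<le> 0"
      using False inner_gt_zero_iff[of q]
      by (simp add: s_def power2_eq_square divide_le_0_iff del: inner_gt_zero_iff)
    then show ?thesis by simp
  qed simp
  then show ?thesis using p(1) by blast
qed

text \<open>The vector \<open>p - p'\<close> lies in \<open>M\<close> and is orthogonal to
  \<open>z - p'\<close> and \<open>z - p\<close>, hence to their difference, which is
  itself.\<close>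

lemma orth_decomposition_unique:
  fixes M :: "'a::real_inner set"
  assumes "subspace M" "p \<in> M" "p' \<in> M"
    and "\<forall>q\<in>M. inner q (z - p) = 0" "\<forall>q\<in>M. inner q (z - p') = 0"
  shows "p = p'"
proof -
  have "p - p' \<in> M" using assms by (simp add: subspace_diff)
  then have "inner (p - p') (z - p') - inner (p - p') (z - p) = 0" using assms by simp
  then show ?thesis by (simp flip: inner_diff_right)
qed

context
  fixes M :: "'a::chilbert_space set"
  assumes M: "csubspace M" "closed M"
begin

lemma orth_proj_eqI:
  assumes "p \<in> M" "\<And>q. q \<in> M \<Longrightarrow> inner q (z - p) = 0"
  shows "orth_proj M z = p"
  unfolding orth_proj_def csubspace_orth_iff[OF M(1)]
  using assms orth_decomposition_unique[OF csubspace_imp_subspace[OF M(1)]]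
  by (intro the_equality) blast+

lemma orth_proj:
  shows orth_proj_in: "orth_proj M z \<in> M"
    and orth_proj_orth: "q \<in> M \<Longrightarrow> inner q (z - orth_proj M z) = 0"
proof -
  obtain p where "p \<in> M" "\<forall>q\<in>M. inner q (z - p) = 0"
    using ex_orth_decomposition[OF csubspace_imp_subspace[OF M(1)] M(2)] by blast
  moreover from this have "orth_proj M z = p" by (intro orth_proj_eqI) auto
  ultimately show "orth_proj M z \<in> M" "q \<in> M \<Longrightarrow> inner q (z - orth_proj M z) = 0" by auto
qed

lemma orth_proj_add: "orth_proj M (x + y) = orth_proj M x + orth_proj M y"
proof (rule orth_proj_eqI)
  fix q assume "q \<in> M"
  then show "inner q (x + y - (orth_proj M x + orth_proj M y)) = 0"
    using orth_proj_orth[of q x] orth_proj_orth[of q y] by (simp add: inner_add_right inner_diff_right)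
qed (use M(1) orth_proj_in in \<open>simp add: csubspace_def\<close>)

text \<open>By Pythagoras the projection is the nearest point of \<open>M\<close>; the same identity
  at q = 0 then gives the formula.\<close>

lemma norm_orth_proj: "(norm (orth_proj M z))\<^sup>2 = (norm z)\<^sup>2 - (infdist z M)\<^sup>2"
proof -
  let ?p = "orth_proj M z"
  have sub: "subspace M" by (rule csubspace_imp_subspace[OF M(1)])
  have pyth: "(norm (z - q))\<^sup>2 = (norm (z - ?p))\<^sup>2 + (norm (?p - q))\<^sup>2" if "q \<in> M" for q
  proof -
    have "?p - q \<in> M" using sub that orth_proj_in by (simp add: subspace_diff)
    then show ?thesis
      using norm_add_Pythagorean[of "?p - q" "z - ?p"] orth_proj_orth
      by (simp add: orthogonal_def)
  qed
  have "dist z ?p \<le> dist z q" if "q \<in> M" for q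
    by (rule power2_le_imp_le) (use pyth[OF that] in \<open>simp_all add: dist_norm\<close>)
  then have "dist z ?p \<le> infdist z M"
    using orth_proj_in by (subst infdist_notempty) (auto intro: cINF_greatest)
  then have "dist z ?p = infdist z M" using infdist_le[OF orth_proj_in] by (simp add: antisym)
  then show ?thesis using pyth[OF subspace_0[OF sub]] by (simp add: dist_norm)
qed

text \<open>Since \<open>w - orth_proj M w\<close> is orthogonal to \<open>M\<close>,
  \<open>w\<close> may be replaced by its projection; additivity then allows polarization.\<close>

lemma inner_orth_proj:
  "inner w (orth_proj M z)
    = ((norm (orth_proj M (w + z)))\<^sup>2 - (norm (orth_proj M w))\<^sup>2 - (norm (orth_proj M z))\<^sup>2) / 2"
proof -
  have "inner w (orth_proj M z) = inner (orth_proj M w) (orth_proj M z)"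
    using orth_proj_orth[OF orth_proj_in[of z], of w]
    by (simp add: inner_diff_right inner_commute)
  then show ?thesis by (simp add: orth_proj_add dot_norm)
qed

end


section \<open>Weak measurability\<close>

lemma weakly_measurable_iff_inner:
  "weakly_measurable g \<longleftrightarrow> (\<forall>h. (\<lambda>t. inner h (g t)) \<in> borel_measurable lebesgue)"
proof
  assume "weakly_measurable g"
  then show "\<forall>h. (\<lambda>t. inner h (g t)) \<in> borel_measurable lebesgue"
    by (auto simp: weakly_measurable_def inner_eq_Re_cinner borel_measurable_complex_iff)
next
  assume "\<forall>h. (\<lambda>t. inner h (g t)) \<in> borel_measurable lebesgue"
  then show "weakly_measurable g"
    by (simp add: weakly_measurable_def cinner_eq_inner borel_measurable_complex_iff)
qed

lemma weakly_measurable_const: "weakly_measurable (\<lambda>t. c)"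
  by (simp add: weakly_measurable_def)

lemma weakly_measurable_add:
  "weakly_measurable f \<Longrightarrow> weakly_measurable g \<Longrightarrow> weakly_measurable (\<lambda>t. f t + g t)"
  by (auto simp: weakly_measurable_def cinner_add_right intro: borel_measurable_add)

lemma weakly_measurable_diff:
  "weakly_measurable f \<Longrightarrow> weakly_measurable g \<Longrightarrow> weakly_measurable (\<lambda>t. f t - g t)"
  by (auto simp: weakly_measurable_iff_inner inner_diff_right intro: borel_measurable_diff)

lemma weakly_measurable_scaleC:
  "a \<in> borel_measurable lebesgue \<Longrightarrow> weakly_measurable f \<Longrightarrow> weakly_measurable (\<lambda>t. a t *\<^sub>C f t)"
  by (auto simp: weakly_measurable_def cinner_scaleC_right intro: borel_measurable_times)

lemma weakly_measurable_Pair: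
  "weakly_measurable f \<Longrightarrow> weakly_measurable g \<Longrightarrow> weakly_measurable (\<lambda>t. (f t, g t))"
  by (auto simp: weakly_measurable_def cinner_prod_def intro: borel_measurable_add)

lemma weakly_measurable_fst: "weakly_measurable f \<Longrightarrow> weakly_measurable (\<lambda>t. fst (f t))"
  unfolding weakly_measurable_iff_inner
  by (rule allI, drule_tac x = "(h, 0)" in spec) (simp add: inner_prod_def)

lemma weakly_measurable_snd: "weakly_measurable f \<Longrightarrow> weakly_measurable (\<lambda>t. snd (f t))"
  unfolding weakly_measurable_iff_inner
  by (rule allI, drule_tac x = "(0, h)" in spec) (simp add: inner_prod_def)

text \<open>One direction is Cauchy-Schwarz. Conversely the condition on \<open>d\<close> is closed,
  so it extends from \<open>D\<close> to all vectors and may be tested at d = x. A countable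
  \<open>D\<close> makes the norm bound a countable conjunction.\<close>

lemma norm_le_iff_dense:
  fixes x :: "'a::real_inner"
  assumes "closure D = UNIV" "0 \<le> a"
  shows "norm x \<le> a \<longleftrightarrow> (\<forall>d\<in>D. inner d x \<le> a * norm d)"
proof
  assume "norm x \<le> a"
  then show "\<forall>d\<in>D. inner d x \<le> a * norm d"
    by (metis norm_cauchy_schwarz order_trans mult.commute mult_left_mono norm_ge_zero)
next
  assume *: "\<forall>d\<in>D. inner d x \<le> a * norm d"
  have "closed {d. inner d x \<le> a * norm d}" by (intro closed_Collect_le continuous_intros)
  then have "closure D \<subseteq> {d. inner d x \<le> a * norm d}" using * by (intro closure_minimal) auto
  then have "inner x x \<le> a * norm x" using assms(1) by auto
  then have "norm x * norm x \<le> a * norm x" by (simp add: dot_square_norm power2_eq_square)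
  then show "norm x \<le> a" using assms(2) by (cases "x = 0") auto
qed

lemma weakly_measurable_norm:
  fixes g :: "real \<Rightarrow> 'a::complex_inner"
  assumes D: "countable D" "closure D = (UNIV :: 'a set)" and g: "weakly_measurable g"
  shows "(\<lambda>t. norm (g t)) \<in> borel_measurable lebesgue"
  unfolding borel_measurable_iff_le
proof
  fix a
  have [measurable]: "(\<lambda>t. inner h (g t)) \<in> borel_measurable lebesgue" for h
    using g by (simp add: weakly_measurable_iff_inner)
  show "{t \<in> space lebesgue. norm (g t) \<le> a} \<in> sets lebesgue"
  proof (cases "0 \<le> a")
    case True
    have "{t \<in> space lebesgue. \<forall>d\<in>D. inner d (g t) \<le> a * norm d} \<in> sets lebesgue"
      using D(1) by measurable
    then show ?thesis using True by (simp add: norm_le_iff_dense[OF D(2)])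
  next
    \<comment> \<open>The test by \<open>D\<close> requires a nonnegative bound; for negative
      \<open>a\<close> the sublevel set is empty.\<close>
    case False
    then have "{t \<in> space lebesgue. norm (g t) \<le> a} = {}"
      using norm_ge_zero order_trans by blast
    then show ?thesis by simp
  qed
qed

lemma weakly_measurable_orth_proj:
  fixes M :: "real \<Rightarrow> 'a::chilbert_space set"
  assumes D: "countable D" "closure D = (UNIV :: 'a set)"
    and M: "\<And>t. csubspace (M t)" "\<And>t. closed (M t)"
    and I: "countable I" and g: "\<And>i. i \<in> I \<Longrightarrow> weakly_measurable (g i)"
    and dense: "AE t in lebesgue. M t = closure ((\<lambda>i. g i t) ` I)"
    and f: "weakly_measurable f"
  shows "weakly_measurable (\<lambda>t. orth_proj (M t) (f t))"
  unfolding weakly_measurable_iff_inner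
proof
  fix w :: 'a
  \<comment> \<open>\<open>\<delta>\<close> is the distance to the countable family and is
    measurable without reference to \<open>M\<close>. Where the family is dense in
    \<open>M t\<close>, \<open>N\<close> is the squared norm of the projection.\<close>
  define \<delta> where "\<delta> z t = (INF i\<in>I. norm (z t - g i t))" for z t
  define N where "N z t = (norm (z t))\<^sup>2 - (\<delta> z t)\<^sup>2" for z t
  have N_meas [measurable]: "N z \<in> borel_measurable lebesgue" if "weakly_measurable z" for z
  proof -
    have [measurable]: "\<delta> z \<in> borel_measurable lebesgue"
      unfolding \<delta>_def
      by (intro borel_measurable_cINF I bdd_belowI2[where m = 0] weakly_measurable_norm[OF D]
          weakly_measurable_diff that g norm_ge_zero)
    have [measurable]: "(\<lambda>t. norm (z t)) \<in> borel_measurable lebesgue"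
      by (rule weakly_measurable_norm[OF D that])
    show ?thesis unfolding N_def by measurable
  qed
  have N_eq: "N z t = (norm (orth_proj (M t) (z t)))\<^sup>2"
    if t: "M t = closure ((\<lambda>i. g i t) ` I)" for z t
  proof -
    \<comment> \<open>Nonemptiness follows from 0 being in \<open>M t\<close>; it rules out the
      default value 0 of \<open>infdist\<close> on the empty set.\<close>
    have "(\<lambda>i. g i t) ` I \<noteq> {}" using t M(1)[of t] by (auto simp: csubspace_def)
    then have "infdist (z t) (M t) = \<delta> z t"
      unfolding t infdist_eq_setdist setdist_closure_2
      by (simp add: infdist_notempty \<delta>_def dist_norm image_image flip: infdist_eq_setdist)
    then show ?thesis by (simp add: N_def norm_orth_proj[OF M])
  qed
  let ?w = "\<lambda>t::real. w"
  have "(\<lambda>t. (N (\<lambda>t. w + f t) t - N ?w t - N f t) / 2) \<in> borel_measurable lebesgue"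
    using f by (intro borel_measurable_divide borel_measurable_diff N_meas weakly_measurable_add
        weakly_measurable_const) auto
  moreover have "AE t in lebesgue.
      (N (\<lambda>t. w + f t) t - N ?w t - N f t) / 2 = inner w (orth_proj (M t) (f t))"
    using dense by eventually_elim (unfold inner_orth_proj[OF M], simp only: N_eq)
  \<comment> \<open>Completeness of Lebesgue measure transfers measurability across the exceptional
    null set.\<close>
  ultimately show "(\<lambda>t. inner w (orth_proj (M t) (f t))) \<in> borel_measurable lebesgue"
    by (rule borel_measurable_AE)
qed


section \<open>Graphs and resolvents\<close>

lemma in_graph_iff: "x \<in> Map.graph T \<longleftrightarrow> fst x \<in> dom T \<and> snd x = the (T (fst x))"
  by (cases x) (auto simp: graph_eq_to_snd_dom)

lemma csubspace_graph:
  assumes "linear_operator T"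
  shows "csubspace (Map.graph T)"
proof -
  \<comment> \<open>Needed for 0 to lie in the graph; additivity at 0 + 0 yields it.\<close>
  have "the (T 0) = 0"
  proof -
    have "0 \<in> dom T" "the (T (0 + 0)) = the (T 0) + the (T 0)"
      using assms unfolding linear_operator_def csubspace_def by blast+
    then show ?thesis by simp
  qed
  then show ?thesis
    using assms unfolding csubspace_def linear_operator_def
    by (simp add: scaleC_prod_def in_graph_iff)
qed

text \<open>Solving T f - z f = h gives f = R h and T f = h + z R h, with R the resolvent;
  bijectivity makes every \<open>f\<close> in the domain occur.\<close>

lemma graph_eq_range_resolvent:
  assumes "z \<in> resolvent_set T"
  shows "Map.graph T = range (\<lambda>h. (resolvent T z h, h + z *\<^sub>C resolvent T z h))"
    (is "_ = range ?V")
proof (rule set_eqI)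
  let ?S = "\<lambda>f. the (T f) - z *\<^sub>C f"
  have bij: "bij_betw ?S (dom T) UNIV" using assms by (simp add: resolvent_set_def)
  fix x :: "'a \<times> 'a"
  show "x \<in> Map.graph T \<longleftrightarrow> x \<in> range ?V"
  proof
    assume "x \<in> Map.graph T"
    then have x: "fst x \<in> dom T" "snd x = the (T (fst x))"
      by (simp_all add: in_graph_iff)
    then have "resolvent T z (?S (fst x)) = fst x"
      using bij_betw_inv_into_left[OF bij] by (simp add: resolvent_def)
    then have "x = ?V (?S (fst x))" using x by (simp add: prod_eq_iff)
    then show "x \<in> range ?V" by blast
  next
    assume "x \<in> range ?V"
    then obtain h where h: "x = ?V h" by blast
    have "?S (resolvent T z h) = h" "resolvent T z h \<in> dom T"
      using bij_betw_inv_into_right[OF bij] bij_betw_apply[OF bij_betw_inv_into[OF bij]]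
      by (simp_all add: resolvent_def)
    moreover from this have "the (T (resolvent T z h)) = h + z *\<^sub>C resolvent T z h"
      by (simp only: diff_eq_eq)
    ultimately show "x \<in> Map.graph T" by (simp add: h in_graph_iff)
  qed
qed

text \<open>Boundedness of the resolvent makes \<open>?V\<close> continuous, so the image of
  \<open>D\<close> is dense in its range, the graph. Closedness of the operator gives the other
  inclusion.\<close>

lemma graph_eq_closure_resolvent:
  assumes "z \<in> resolvent_set T" "closed_operator T" "closure D = UNIV"
  shows "Map.graph T = closure ((\<lambda>h. (resolvent T z h, h + z *\<^sub>C resolvent T z h)) ` D)"
    (is "_ = closure (?V ` D)")
proof
  note graph = graph_eq_range_resolvent[OF assms(1)]
  have R: "bounded_linear (resolvent T z)"
    using assms(1) by (simp add: resolvent_set_def bounded_clinear_def)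
  have "continuous_on (closure D) ?V"
    by (intro continuous_intros linear_continuous_on R
        bounded_linear_compose[OF bounded_linear_scaleC R])
  then have "?V ` closure D \<subseteq> closure (?V ` D)"
    by (rule image_closure_subset) (auto simp: closure_subset)
  then show "Map.graph T \<subseteq> closure (?V ` D)" by (simp add: graph assms(3))
  show "closure (?V ` D) \<subseteq> Map.graph T"
    using assms(2) by (intro closure_minimal) (auto simp: graph closed_operator_def)
qed

theorem theorem4p11:
  fixes T :: "real \<Rightarrow> 'a::chilbert_space \<rightharpoonup> 'a"
    and \<alpha> :: "real \<Rightarrow> complex"
  assumes separable: "separable_space (euclidean :: 'a topology)"
    and T: "\<And>t. linear_operator (T t) \<and> densely_defined (T t) \<and> closed_operator (T t)"
    and \<alpha>_measurable: "\<alpha> \<in> borel_measurable lebesgue"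
    and \<alpha>_resolvent: "AE t in lebesgue. \<alpha> t \<in> resolvent_set (T t)"
    and resolvent_measurable: "weakly_measurable_op (\<lambda>t. Some \<circ> resolvent (T t) (\<alpha> t))"
  shows "N_measurable T"
proof -
  obtain D :: "'a set" where D: "countable D" "closure D = UNIV"
    using separable by (auto simp: separable_space_def)
  \<comment> \<open>\<open>D \<times> D\<close> supplies the test vectors for norms in the direct
    sum, while \<open>D\<close> indexes the dense family in each graph.\<close>
  have DD: "countable (D \<times> D)" "closure (D \<times> D) = UNIV"
    using D by (simp_all add: closure_Times)
  define V where "V h t = (resolvent (T t) (\<alpha> t) h, h + \<alpha> t *\<^sub>C resolvent (T t) (\<alpha> t) h)" for h t
  \<comment> \<open>The operator family is applied to the constant vector family \<open>h\<close>,
    admissible because the resolvents are total functions.\<close>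
  have "weakly_measurable (\<lambda>t. resolvent (T t) (\<alpha> t) h)" for h
    using resolvent_measurable weakly_measurable_const[of h]
    by (auto simp: weakly_measurable_op_def dest: spec[where x = "\<lambda>_. h"])
  then have V: "weakly_measurable (V h)" for h
    unfolding V_def
    by (intro weakly_measurable_Pair weakly_measurable_add weakly_measurable_scaleC
        weakly_measurable_const \<alpha>_measurable)
  have dense: "AE t in lebesgue. Map.graph (T t) = closure ((\<lambda>d. V d t) ` D)"
    using \<alpha>_resolvent
    by eventually_elim (use T D(2) in \<open>simp add: V_def graph_eq_closure_resolvent\<close>)
  have P: "weakly_measurable (\<lambda>t. orth_proj (Map.graph (T t)) (f t))" if "weakly_measurable f" for f
    using T by (intro weakly_measurable_orth_proj[OF DD _ _ D(1) V dense that])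
      (auto simp: csubspace_graph closed_operator_def)
  \<comment> \<open>An entry embeds \<open>f t\<close> as one component of a pair, projects, and
    reads off a component; each operation preserves weak measurability.\<close>
  have "weakly_measurable (\<lambda>t. block_entry (orth_proj (Map.graph (T t))) j k (f t))"
    if "weakly_measurable f" for j k f
    unfolding block_entry_def Let_def using that
    by (cases "j = 1"; cases "k = 1")
      (simp_all add: P weakly_measurable_fst weakly_measurable_snd weakly_measurable_Pair
        weakly_measurable_const)
  then show ?thesis
    by (simp add: N_measurable_def weakly_measurable_op_def)
qed

end
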